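(* Let $x\in(0,1]$ and let $w\in\Lambda_n(x)$ with $n\in\mathbb{N}$. Then for any $m\in\mathbb{N}$ and $v\in\Sigma_m(\underline{\beta}(w))$, we have $wv\in\Omega_{n+m}(x)$. Furthermore, if $v\in\Xi_m(\underline{\beta}(w))$, then $wv\in\Lambda_{n+m}(x)$.
   Context: $\mathbb{N}=\{1,2,\dots\}$; $wv$ denotes concatenation of words. For $\beta>1$ let $T_\beta(y)=\beta y-\lfloor\beta y\rfloor$ on $[0,1]$ and $\varepsilon_n(y,\beta)=\lfloor\beta T_\beta^{n-1}y\rfloor$ for $n\ge1$. Let $\Sigma_n(\beta)=\{\varepsilon_1(y,\beta)\cdots\varepsilon_n(y,\beta)\colon y\in[0,1)\}$; for $w\in\Sigma_n(\beta)$ let $\mathfrak{I}(w)=\{y\in[0,1)\colon\varepsilon_1(y,\beta)\cdots\varepsilon_n(y,\beta)=w\}$ (an interval of length at most $\beta^{-n}$), and $\Xi_n(\beta)=\{w\in\Sigma_n(\beta)\colon|\mathfrak{I}(w)|=\beta^{-n}\}$. For fixed $x\in(0,1]$ let $\Omega_n(x)=\{\varepsilon_1(x,\beta)\cdots\varepsilon_n(x,\beta)\colon\beta>1\}$. For $w=w_1\cdots w_n\in\Omega_n(x)$: $\underline{\beta}(w)=1$ if $w=0^n$; otherwise $\underline{\beta}(w)\ge1$ is the unique positive solution $\beta$ of $x=\sum_{i=1}^n w_i\beta^{-i}$. Let $I(w)=\{\beta>1\colon\varepsilon_1(x,\beta)\cdots\varepsilon_n(x,\beta)=w\}$, $J(w)=\{T_\beta^n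 x\colon\beta\in I(w)\}$, and $\Lambda_n(x)=\{w\in\Omega_n(x)\colon J(w)=[0,1)\}$ (full cylinders in the parameter space). For $w\in\Lambda_n(x)$ one has $\underline{\beta}(w)>1$. *)

theory Defs
  imports "HOL-Analysis.Analysis"
begin

text \<open>Words are lists of integer digits, since the digits are floors of real numbers.\<close>

definition beta_map :: "real \<Rightarrow> real \<Rightarrow> real" where
  "beta_map \<beta> y = \<beta> * y - of_int \<lfloor>\<beta> * y\<rfloor>"

definition digit :: "nat \<Rightarrow> real \<Rightarrow> real \<Rightarrow> int" where
  "digit n y \<beta> = \<lfloor>\<beta> * (beta_map \<beta> ^^ (n - 1)) y\<rfloor>"

text \<open>Digits are numbered from 1, while list positions start at 0.\<close>

definition digits :: "nat \<Rightarrow> real \<Rightarrow> real \<Rightarrow> int list" where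
  "digits n y \<beta> = map (\<lambda>i. digit i y \<beta>) [1..<Suc n]"

definition Sigma_words :: "nat \<Rightarrow> real \<Rightarrow> int list set" where
  "Sigma_words n \<beta> = {digits n y \<beta> | y. y \<in> {0..<1}}"

definition dyn_cylinder :: "real \<Rightarrow> int list \<Rightarrow> real set" where
  "dyn_cylinder \<beta> w = {y \<in> {0..<1}. digits (length w) y \<beta> = w}"

definition Xi_words :: "nat \<Rightarrow> real \<Rightarrow> int list set" where
  "Xi_words n \<beta> = {w \<in> Sigma_words n \<beta>. measure lborel (dyn_cylinder \<beta> w) = 1 / \<beta> ^ n}"

definition Omega_words :: "nat \<Rightarrow> real \<Rightarrow> int list set" where
  "Omega_words n x = {digits n x \<beta> | \<beta>. \<beta> > 1}"

text \<open>The definite description is meant for \<open>w\<close> in \<open>Omega_words (length w) x\<close> with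
  \<open>x \<in> {0<..1}\<close>: a word with some nonzero digit then has nonnegative digits, so the right-hand
  sum is strictly decreasing in \<open>\<beta> > 0\<close> and the solution is unique.\<close>

definition beta_lower :: "real \<Rightarrow> int list \<Rightarrow> real" where
  "beta_lower x w =
    (if w = replicate (length w) 0 then 1
     else (THE \<beta>. \<beta> > 0 \<and> x = (\<Sum>i = 1..length w. of_int (w ! (i - 1)) / \<beta> ^ i)))"

definition param_cylinder :: "real \<Rightarrow> int list \<Rightarrow> real set" where
  "param_cylinder x w = {\<beta>. \<beta> > 1 \<and> digits (length w) x \<beta> = w}"

definition param_image :: "real \<Rightarrow> int list \<Rightarrow> real set" where
  "param_image x w = {(beta_map \<beta> ^^ length w) x | \<beta>. \<beta> \<in> param_cylinder x w}"

definition Lambda_words :: "nat \<Rightarrow> real \<Rightarrow> int list set" where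
  "Lambda_words n x = {w \<in> Omega_words n x. param_image x w = {0..<1}}"

end

theory Submission
  imports Defs
begin

text \<open>
  Reading off the digits \<open>w\<close> of \<open>x\<close> in base \<open>\<beta>\<close> amounts to writing \<open>x\<close> as the value of the
  inverse branch of \<open>T\<^sub>\<beta>\<^sup>n\<close> belonging to \<open>w\<close> at the point \<open>T\<^sub>\<beta>\<^sup>n x\<close>.  That value is continuous and
  strictly decreasing in \<open>\<beta>\<close> and increasing in the point.  Let \<open>b\<close> be the lower endpoint
  \<open>beta_lower x w\<close>; fullness of \<open>w\<close> yields a parameter in the cylinder whose orbit reaches 0,
  and by strict monotonicity this parameter is \<open>b\<close>.

  Suppose \<open>v\<close> is the expansion in base \<open>b\<close> of some \<open>y \<in> [0,1)\<close>, and let \<open>0 \<le> t \<le> T\<^sub>b\<^sup>m y\<close>.  At the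
  parameter \<open>b\<close> the branch of \<open>wv\<close> has value at least \<open>x\<close> at \<open>t\<close>, and it tends to 0 for large
  parameters, so it equals \<open>x\<close> for some \<open>\<beta> \<ge> b\<close>.  Two things then have to be seen: that \<open>v\<close>
  really is the expansion in base \<open>\<beta>\<close> of the intermediate point \<open>s\<close>, and that \<open>w\<close> really is the
  expansion of \<open>x\<close>.  The first holds because enlarging the base shrinks every
  intermediate value, so all of them stay below the orbit of \<open>y\<close> and hence below 1
  (\<open>digits_inv_branch_dominated\<close>).  For the second, fullness of \<open>w\<close> provides some \<open>\<beta>'\<close> in
  the cylinder of \<open>w\<close> with \<open>T\<^sub>\<beta>\<^sub>'\<^sup>n x = s\<close>, and strict monotonicity forces \<open>\<beta>' = \<beta>\<close>.
  Altogether \<open>wv\<close> is realised by a parameter whose orbit ends in \<open>t\<close>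
  (\<open>full_word_append_realised\<close>).

  Taking \<open>t = 0\<close> shows that \<open>wv\<close> is admissible.  If \<open>v\<close> is full, its cylinder has the maximal
  length \<open>b\<^sup>-\<^sup>m\<close>, so \<open>T\<^sub>b\<^sup>m y\<close> comes arbitrarily close to 1 on it (\<open>Xi_words_orbit_ge\<close>).  Every
  \<open>t \<in> [0,1)\<close> is then allowed, which is fullness of \<open>wv\<close>.
\<close>

lemma beta_map_eq_frac: "beta_map \<beta> y = frac (\<beta> * y)"
  by (simp add: beta_map_def frac_def)

lemma beta_map_funpow_range:
  assumes "0 < k"
  shows "(beta_map \<beta> ^^ k) y \<in> {0..<1}"
  using assms by (cases k) (simp_all add: beta_map_eq_frac frac_lt_1)

lemma length_digits [simp]: "length (digits n y \<beta>) = n"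
  by (simp add: digits_def)

lemma digits_0 [simp]: "digits 0 y \<beta> = []"
  by (simp add: digits_def)

lemma digits_Suc: "digits (Suc n) y \<beta> = \<lfloor>\<beta> * y\<rfloor> # digits n (beta_map \<beta> y) \<beta>"
proof (rule nth_equalityI)
  fix i assume "i < length (digits (Suc n) y \<beta>)"
  then show "digits (Suc n) y \<beta> ! i = (\<lfloor>\<beta> * y\<rfloor> # digits n (beta_map \<beta> y) \<beta>) ! i"
    by (cases i) (simp_all add: digits_def digit_def funpow_swap1 del: upt_Suc)
qed simp

lemma digits_add:
  "digits (n + m) y \<beta> = digits n y \<beta> @ digits m ((beta_map \<beta> ^^ n) y) \<beta>"
  by (induction n arbitrary: y) (simp_all add: digits_Suc funpow_swap1)

lemma digits_nonneg:
  assumes "0 \<le> \<beta>" "0 \<le> y" "d \<in> set (digits n y \<beta>)"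
  shows "0 \<le> d"
  using assms
proof (induction n arbitrary: y)
  case (Suc n)
  have "0 \<le> beta_map \<beta> y" by (simp add: beta_map_eq_frac)
  with Suc show ?case by (auto simp: digits_Suc)
qed simp

section \<open>Inverse branches\<close>

text \<open>The branch is taken formally: its value need not lie in the cylinder of the word.\<close>

definition inv_branch :: "real \<Rightarrow> int list \<Rightarrow> real \<Rightarrow> real" where
  "inv_branch \<beta> w t = foldr (\<lambda>d s. (of_int d + s) / \<beta>) w t"

lemma inv_branch_Nil [simp]: "inv_branch \<beta> [] t = t"
  by (simp add: inv_branch_def)

lemma inv_branch_Cons [simp]:
  "inv_branch \<beta> (d # w) t = (of_int d + inv_branch \<beta> w t) / \<beta>"
  by (simp add: inv_branch_def)

lemma inv_branch_append: "inv_branch \<beta> (w @ v) t = inv_branch \<beta> w (inv_branch \<beta> v t)"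
  by (simp add: inv_branch_def)

lemma inv_branch_affine: "inv_branch \<beta> w t = inv_branch \<beta> w 0 + t / \<beta> ^ length w"
  by (induction w) (simp_all add: add_divide_distrib mult.commute)

lemma inv_branch_eq_sum:
  "inv_branch \<beta> w 0 = (\<Sum>i = 1..length w. of_int (w ! (i - 1)) / \<beta> ^ i)"
proof (induction w)
  case (Cons d w)
  have "(\<Sum>i = 1..length (d # w). of_int ((d # w) ! (i - 1)) / \<beta> ^ i)
      = (\<Sum>i<Suc (length w). of_int ((d # w) ! i) / \<beta> ^ Suc i)"
    by (simp add: sum.atLeast1_atMost_eq del: sum.lessThan_Suc sum.cl_ivl_Suc)
  also have "\<dots> = of_int d / \<beta> + (\<Sum>i<length w. of_int (w ! i) / \<beta> ^ Suc i) / \<beta>"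
    unfolding sum.lessThan_Suc_shift by (simp add: sum_divide_distrib mult_ac)
  finally show ?case
    using Cons by (simp add: sum.atLeast1_atMost_eq add_divide_distrib)
qed simp

lemma inv_branch_digits:
  assumes "\<beta> \<noteq> 0" "digits (length w) y \<beta> = w"
  shows "inv_branch \<beta> w ((beta_map \<beta> ^^ length w) y) = y"
  using assms
  by (induction w arbitrary: y)
    (simp_all add: digits_Suc funpow_swap1, simp add: beta_map_def)

lemma inv_branch_nonneg:
  assumes "0 \<le> \<beta>" "\<And>d. d \<in> set w \<Longrightarrow> 0 \<le> d" "0 \<le> t"
  shows "0 \<le> inv_branch \<beta> w t"
  using assms by (induction w) auto

lemma inv_branch_mono_point:
  assumes "0 < \<beta>" "s \<le> t"
  shows "inv_branch \<beta> w s \<le> inv_branch \<beta> w t"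
  using assms by (induction w) (simp_all add: divide_right_mono)

lemma inv_branch_antimono_base:
  assumes "0 < \<beta>" "\<beta> \<le> \<beta>'" "\<And>d. d \<in> set w \<Longrightarrow> 0 \<le> d" "0 \<le> t"
  shows "inv_branch \<beta>' w t \<le> inv_branch \<beta> w t"
  using assms
proof (induction w)
  case (Cons d w)
  have "0 \<le> inv_branch \<beta>' w t" using Cons.prems by (intro inv_branch_nonneg) auto
  with Cons show ?case by (auto intro!: frac_le)
qed simp

lemma inv_branch_base_unique:
  assumes "0 < \<beta>" "0 < \<beta>'" "w \<noteq> []" "\<And>d. d \<in> set w \<Longrightarrow> 0 \<le> d" "0 \<le> t"
    and "0 < x" "inv_branch \<beta> w t = x" "inv_branch \<beta>' w t = x"
  shows "\<beta> = \<beta>'"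
proof -
  have False if *: "0 < a" "a < c" "inv_branch a w t = x" "inv_branch c w t = x" for a c
  proof -
    obtain d u where w: "w = d # u" using \<open>w \<noteq> []\<close> by (cases w) auto
    have le: "inv_branch c u t \<le> inv_branch a u t"
      using * assms w by (intro inv_branch_antimono_base) auto
    have eqs: "of_int d + inv_branch a u t = x * a" "of_int d + inv_branch c u t = x * c"
      using * w by (auto simp: field_simps)
    have "x * a < x * c" using * \<open>0 < x\<close> by simp
    with le eqs show False by linarith
  qed
  with assms show ?thesis by (metis linorder_neq_iff)
qed

lemma continuous_on_inv_branch:
  assumes "0 \<notin> S"
  shows "continuous_on S (\<lambda>\<beta>. inv_branch \<beta> w t)"
  using assms by (induction w) (auto intro!: continuous_intros)

lemma inv_branch_attains:
  assumes "0 < b" "w \<noteq> []" "\<And>d. d \<in> set w \<Longrightarrow> 0 \<le> d" "0 \<le> t"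
    and "0 < x" "x \<le> inv_branch b w t"
  obtains \<beta> where "b \<le> \<beta>" "inv_branch \<beta> w t = x"
proof -
  obtain d u where w: "w = d # u" using \<open>w \<noteq> []\<close> by (cases w) auto
  let ?C = "of_int d + inv_branch b u t"
  \<comment> \<open>Beyond \<open>b\<close> the value is at most \<open>?C / \<beta>\<close>, hence at most \<open>x\<close> once \<open>\<beta> \<ge> ?C / x\<close>.\<close>
  define B where "B = max b (?C / x)"
  have B: "b \<le> B" "?C / x \<le> B" by (simp_all add: B_def)
  have "inv_branch B u t \<le> inv_branch b u t"
    using assms w B by (intro inv_branch_antimono_base) auto
  then have "inv_branch B w t \<le> ?C / B"
    using w B \<open>0 < b\<close> by (simp add: divide_right_mono)
  also have "\<dots> \<le> x" using B \<open>0 < b\<close> \<open>0 < x\<close> by (simp add: field_simps)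
  finally have "inv_branch B w t \<le> x" .
  moreover have "continuous_on {b..B} (\<lambda>\<beta>. inv_branch \<beta> w t)"
    using \<open>0 < b\<close> by (intro continuous_on_inv_branch) auto
  ultimately obtain \<beta> where "b \<le> \<beta>" "inv_branch \<beta> w t = x"
    using IVT2'[of "\<lambda>\<beta>. inv_branch \<beta> w t" B x b] assms B by blast
  then show thesis by (rule that)
qed

section \<open>Transporting words to larger bases\<close>

text \<open>
  A point of the inverse branch is expanded by the prescribed digits as soon as all intermediate
  values lie in \<open>[0,1)\<close>.  Working back from the end of the word, the orbit of \<open>y\<close> in the smaller
  base bounds these values from above, because dividing by the larger base gives
  the smaller result.
\<close>

lemma digits_inv_branch_dominated:
  assumes "0 < b" "b \<le> \<beta>" "0 \<le> y" "y < 1" "digits (length v) y b = v"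
    and "0 \<le> t" "t \<le> (beta_map b ^^ length v) y"
  shows "0 \<le> inv_branch \<beta> v t \<and> inv_branch \<beta> v t \<le> y
    \<and> digits (length v) (inv_branch \<beta> v t) \<beta> = v
    \<and> (beta_map \<beta> ^^ length v) (inv_branch \<beta> v t) = t"
  using assms(3-)
proof (induction v arbitrary: y)
  case (Cons d v)
  define s where "s = inv_branch \<beta> v t"
  have d: "d = \<lfloor>b * y\<rfloor>" and v: "digits (length v) (beta_map b y) b = v"
    using Cons.prems(3) by (simp_all add: digits_Suc)
  have y1: "0 \<le> beta_map b y" "beta_map b y < 1"
    by (simp_all add: beta_map_eq_frac frac_lt_1)
  have IH: "0 \<le> s" "s \<le> beta_map b y" "digits (length v) s \<beta> = v"
      "(beta_map \<beta> ^^ length v) s = t"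
    using Cons.IH[OF y1 v] Cons.prems by (simp_all add: s_def funpow_swap1)
  define z where "z = inv_branch \<beta> (d # v) t"
  have z: "z = (of_int d + s) / \<beta>" by (simp add: z_def s_def)
  have bz: "\<beta> * z = of_int d + s" using assms(1,2) by (simp add: z)
  have "0 \<le> d" using d \<open>0 < b\<close> \<open>0 \<le> y\<close> by simp
  have fl: "\<lfloor>\<beta> * z\<rfloor> = d" using IH y1 by (simp add: bz floor_unique)
  have Tz: "beta_map \<beta> z = s" by (simp add: beta_map_def fl, simp add: bz)
  have "z \<le> (of_int d + beta_map b y) / b"
    unfolding z using IH y1 \<open>0 \<le> d\<close> assms(1,2) by (intro frac_le) auto
  also have "\<dots> = y" using \<open>0 < b\<close> by (simp add: beta_map_def d)
  finally have "z \<le> y" .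
  moreover have "0 \<le> z" unfolding z using IH \<open>0 \<le> d\<close> assms(1,2) by simp
  moreover have "digits (length (d # v)) z \<beta> = d # v"
    using IH by (simp add: digits_Suc fl Tz)
  moreover have "(beta_map \<beta> ^^ length (d # v)) z = t"
    using IH Tz by (simp add: funpow_swap1)
  ultimately show ?case by (simp add: z_def)
qed simp

section \<open>Full words\<close>

text \<open>
  On the cylinder of \<open>v\<close> the map \<open>T\<^sub>b\<^sup>m\<close> is affine with slope \<open>b\<^sup>m\<close>.  If its values there stayed
  below some \<open>t < 1\<close>, the cylinder would have length at most \<open>t b\<^sup>-\<^sup>m\<close>.
\<close>

lemma Xi_words_orbit_ge:
  assumes "1 < b" "v \<in> Xi_words m b" "0 \<le> t" "t < 1"
  obtains y where "y \<in> {0..<1}" "digits m y b = v" "t \<le> (beta_map b ^^ m) y"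
proof (rule ccontr)
  assume "\<not> thesis"
  then have lt: "(beta_map b ^^ m) y < t" if "y \<in> {0..<1}" "digits m y b = v" for y
    using that \<open>\<And>y. _ \<Longrightarrow> _ \<Longrightarrow> _ \<Longrightarrow> thesis\<close> by force
  have len: "length v = m" and meas: "measure lborel (dyn_cylinder b v) = 1 / b ^ m"
    using assms(2) by (auto simp: Xi_words_def Sigma_words_def)
  define c where "c = inv_branch b v 0"
  have sub: "dyn_cylinder b v \<subseteq> {c..c + t / b ^ m}"
  proof
    fix y assume "y \<in> dyn_cylinder b v"
    then have y: "y \<in> {0..<1}" "digits m y b = v"
      by (auto simp: dyn_cylinder_def len)
    have "0 \<le> (beta_map b ^^ m) y"
      using y beta_map_funpow_range[of m b y] by (cases "m = 0") auto
    moreover have "y = c + (beta_map b ^^ m) y / b ^ m"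
      using inv_branch_digits[of b v y] inv_branch_affine[of b v "(beta_map b ^^ m) y"]
        y assms(1) by (simp add: len c_def)
    moreover have "(beta_map b ^^ m) y / b ^ m \<le> t / b ^ m"
      using lt[OF y] assms(1) by (intro divide_right_mono) auto
    ultimately show "y \<in> {c..c + t / b ^ m}"
      using assms(1) by (smt (verit) atLeastAtMost_iff divide_nonneg_pos zero_less_power)
  qed
  have pos: "0 < b ^ m" using assms(1) by simp
  \<comment> \<open>A nonmeasurable set would have measure 0 by convention.\<close>
  have "dyn_cylinder b v \<in> sets lborel"
    using meas assms(1) measure_notin_sets[of "dyn_cylinder b v" lborel] by auto
  then have "measure lborel (dyn_cylinder b v) \<le> measure lborel {c..c + t / b ^ m}"
    using sub by (intro measure_mono_fmeasurable fmeasurableI) (auto simp: emeasure_lborel_Icc_eq)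
  also have "\<dots> = t / b ^ m" using pos assms(3) by simp
  also have "\<dots> < 1 / b ^ m" using pos assms(4) by (simp add: divide_strict_right_mono)
  finally show False using meas by simp
qed

lemma Lambda_wordsD:
  assumes "w \<in> Lambda_words n x" "t \<in> {0..<1}"
  obtains \<beta> where "1 < \<beta>" "digits n x \<beta> = w" "(beta_map \<beta> ^^ n) x = t"
proof -
  have "length w = n" using assms(1) by (auto simp: Lambda_words_def Omega_words_def)
  moreover have "t \<in> param_image x w" using assms by (auto simp: Lambda_words_def)
  ultimately show thesis
    using that by (auto simp: param_image_def param_cylinder_def)
qed

text \<open>
  Fullness supplies a parameter \<open>b > 1\<close> of the cylinder with \<open>T\<^sub>b\<^sup>n x = 0\<close>.  It solves the equation
  defining \<open>beta_lower\<close>, and the solution is unique because the branch is strictly decreasing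
  in the base.
\<close>

lemma beta_lower_full_word:
  assumes "0 < x" "1 \<le> n" "w \<in> Lambda_words n x"
  shows "1 < beta_lower x w" "inv_branch (beta_lower x w) w 0 = x"
proof -
  obtain b where b: "1 < b" "digits n x b = w" "(beta_map b ^^ n) x = 0"
    using Lambda_wordsD[OF assms(3), of 0] by auto
  have len: "length w = n" using b(2) by auto
  have nonneg: "0 \<le> d" if "d \<in> set w" for d
    using digits_nonneg[of b x d n] b assms(1) that by auto
  have bx: "inv_branch b w 0 = x" using inv_branch_digits[of b w x] b len by simp
  have "inv_branch b (replicate k 0) 0 = 0" for k by (induction k) simp_all
  then have "w \<noteq> replicate (length w) 0" using bx assms(1) by (metis less_irrefl)
  then have "beta_lower x w = (THE \<beta>. \<beta> > 0 \<and> x = inv_branch \<beta> w 0)"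
    by (simp add: beta_lower_def inv_branch_eq_sum)
  also have "\<dots> = b"
  proof (rule the_equality)
    fix \<beta> assume "0 < \<beta> \<and> x = inv_branch \<beta> w 0"
    then show "\<beta> = b"
      using bx b(1) assms(1,2) len nonneg
      by (intro inv_branch_base_unique[of \<beta> b w 0 x]) auto
  qed (use b bx in auto)
  finally show "1 < beta_lower x w" "inv_branch (beta_lower x w) w 0 = x"
    using b bx by simp_all
qed

text \<open>
  Solving \<open>inv_branch \<beta> (w @ v) t = x\<close> for \<open>\<beta>\<close> produces the parameter.  The solution satisfies
  \<open>\<beta> \<ge> b\<close>, so domination handles \<open>v\<close>; fullness of \<open>w\<close> identifies \<open>\<beta>\<close> as a parameter in its cylinder.
\<close>

lemma full_word_append_realised:
  assumes "0 < x" "1 \<le> n" "w \<in> Lambda_words n x"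
    and y: "y \<in> {0..<1}" "digits m y (beta_lower x w) = v"
    and t: "0 \<le> t" "t \<le> (beta_map (beta_lower x w) ^^ m) y"
  obtains \<beta> where "1 < \<beta>" "digits (n + m) x \<beta> = w @ v" "(beta_map \<beta> ^^ (n + m)) x = t"
proof -
  define b where "b = beta_lower x w"
  have b: "1 < b" "inv_branch b w 0 = x"
    using beta_lower_full_word[OF assms(1-3)] by (simp_all add: b_def)
  have len: "length w = n" using assms(3) by (auto simp: Lambda_words_def Omega_words_def)
  have lenv: "length v = m" using y(2) by auto
  obtain a where "1 < a" "digits n x a = w" using Lambda_wordsD[OF assms(3), of 0] by auto
  then have w_nonneg: "0 \<le> d" if "d \<in> set w" for d
    using digits_nonneg[of a x d n] assms(1) that by auto
  have v_nonneg: "0 \<le> d" if "d \<in> set v" for d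
    using digits_nonneg[of b y d m] b y that by (auto simp: b_def)
  have "x \<le> inv_branch b (w @ v) t"
    using inv_branch_mono_point[of b 0 "inv_branch b v t" w] b
      inv_branch_nonneg[of b v t] v_nonneg t
    by (simp add: inv_branch_append)
  then obtain \<beta> where \<beta>: "b \<le> \<beta>" "inv_branch \<beta> (w @ v) t = x"
    using inv_branch_attains[of b "w @ v" t x] b t(1) assms(1,2) len w_nonneg v_nonneg by force
  define s where "s = inv_branch \<beta> v t"
  have s: "0 \<le> s" "s \<le> y" "digits m s \<beta> = v" "(beta_map \<beta> ^^ m) s = t"
    using digits_inv_branch_dominated[of b \<beta> y v t] b \<beta>(1) y t lenv
    by (auto simp: s_def b_def)
  obtain \<beta>' where \<beta>': "1 < \<beta>'" "digits n x \<beta>' = w" "(beta_map \<beta>' ^^ n) x = s"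
    using Lambda_wordsD[OF assms(3), of s] s y by auto
  have "inv_branch \<beta>' w s = x" using inv_branch_digits[of \<beta>' w x] \<beta>' len by simp
  moreover have "inv_branch \<beta> w s = x" using \<beta>(2) by (simp add: inv_branch_append s_def)
  moreover have "w \<noteq> []" using len assms(2) by auto
  ultimately have "\<beta> = \<beta>'"
    using b \<beta>(1) \<beta>'(1) w_nonneg s(1) assms(1)
    by (intro inv_branch_base_unique[of \<beta> \<beta>' w s x]) auto
  moreover have "(beta_map \<beta> ^^ (n + m)) x = (beta_map \<beta> ^^ m) ((beta_map \<beta> ^^ n) x)"
    unfolding add.commute[of n m] by (simp add: funpow_add)
  ultimately show thesis
    using that[of \<beta>] \<beta>' s by (simp add: digits_add)
qed

theorem lemma4p2:
  fixes x :: real and n :: nat and w :: "int list"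
  assumes "0 < x" and "x \<le> 1"
    and "n \<ge> 1"
    and "w \<in> Lambda_words n x"
  shows "\<forall>m::nat. m \<ge> 1 \<longrightarrow> (\<forall>v \<in> Sigma_words m (beta_lower x w).
           w @ v \<in> Omega_words (n + m) x \<and>
           (v \<in> Xi_words m (beta_lower x w) \<longrightarrow> w @ v \<in> Lambda_words (n + m) x))"
proof (intro allI impI ballI conjI)
  fix m :: nat and v assume "1 \<le> m" and v: "v \<in> Sigma_words m (beta_lower x w)"
  note realised = full_word_append_realised[OF assms(1,3,4)]
  from v obtain y where y: "y \<in> {0..<1}" "digits m y (beta_lower x w) = v"
    by (auto simp: Sigma_words_def)
  have "0 \<le> (beta_map (beta_lower x w) ^^ m) y"
    using beta_map_funpow_range[of m "beta_lower x w" y] \<open>1 \<le> m\<close> by auto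
  then obtain \<beta> where \<beta>: "1 < \<beta>" "digits (n + m) x \<beta> = w @ v"
    using realised[OF y, of 0] by auto
  then show omega: "w @ v \<in> Omega_words (n + m) x"
    unfolding Omega_words_def by force
  have len: "length (w @ v) = n + m" using \<beta>(2) by (metis length_digits)

  assume xi: "v \<in> Xi_words m (beta_lower x w)"
  have "t \<in> param_image x (w @ v)" if t: "t \<in> {0..<1}" for t
  proof -
    obtain z where z: "z \<in> {0..<1}" "digits m z (beta_lower x w) = v"
        "t \<le> (beta_map (beta_lower x w) ^^ m) z"
      using Xi_words_orbit_ge[OF beta_lower_full_word(1)[OF assms(1,3,4)] xi, of t] t by auto
    obtain \<beta> where "1 < \<beta>" "digits (n + m) x \<beta> = w @ v" "(beta_map \<beta> ^^ (n + m)) x = t"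
      using realised[OF z(1,2) _ z(3)] t by auto
    then show ?thesis
      using len unfolding param_image_def param_cylinder_def by force
  qed
  moreover have "param_image x (w @ v) \<subseteq> {0..<1}"
    using beta_map_funpow_range[of "n + m"] \<open>1 \<le> m\<close> len
    unfolding param_image_def by fastforce
  ultimately show "w @ v \<in> Lambda_words (n + m) x"
    using omega by (auto simp: Lambda_words_def)
qed

end
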